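(* (Few Rejections.) For the single-machine algorithm $\mathcal{A}$ described in the context, the total weight of the jobs in $J^{imm}$ (immediately rejected jobs) plus the total weight of the jobs that ever enter the set $L$ is at most $O(\epsilon)$ times the total weight of all released jobs.
   Context: Single machine; a finite set of jobs arrives online; job $j$ has integer release time $r_j$, integer processing time $p_j>0$ and weight $w_j>0$; its density is $\rho_j=w_j/p_j$. The parameter $\epsilon$ satisfies $\epsilon^2\le 1/2$ and $1/\epsilon\in\mathbb{Z}$. For $x>0$, $\lfloor x\rfloor_2$ denotes the largest integer $i$ with $2^i\le x$; $\lfloor\rho_j\rfloor_2$ is the density class of $j$. Algorithm $\mathcal{A}$ (which may reject and preempt) works in unit time slots. A job is active at time $t$ if it has been released by $t$, has not finished by $t$ and has not been rejected; $A(t)$ is the active set. $p_j(t)$ is the remaining processing time of $j$ at time $t$ and $w_j(t)=\rho_j p_j(t)$. A set $L$ of "preemptible" jobs is maintained; once a job enters $L$ it stays there until it finishes. At each integer time $t$: (1) each job arriving at $t$ (jobs arriving simultaneously are considered one at a time in a fixed arbitrary order, steps (1)-(2) being done for each) is either immediately rejected by the rule below or added to the active set; (2) if the job $j$ processed in slot $[t-1,t]$ is not in $L$, let $t'$ be the time $\mathcal{A}$ started processing $j$ (so $j$ was processed uninterruptedly during $[t',t]$); if the total weight of jobs arriving during $(t',t]$ exceeds $w_j/\epsilon$, then $j$ is added to $L$; (3) if the job processed in $[t-1,t]$ has not finished and is not in $L$, it is processed in $[t,t+1]$; otherwise $\mathcal{A}$ processes in $[t,t+1]$ an active job of highest density.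 Immediate rejection rule. For an arriving job $j$, $A(r_j)$ denotes the jobs active at time $r_j$, excluding $j$ and excluding jobs arriving at $r_j$ that are considered after $j$. Let $D_j^+=\{j'\in A(r_j):\lfloor\rho_{j'}\rfloor_2\ge\lfloor\rho_j\rfloor_2\}$, $D_j^-=A(r_j)\setminus D_j^+$, $\alpha_j^+=w_j\sum_{j'\in D_j^+,\rho_{j'}\ge\rho_j}p_{j'}(r_j)+p_j\sum_{j'\in D_j^+,\rho_{j'}<\rho_j}w_{j'}(r_j)$ and $\alpha_j^-=p_j\sum_{j'\in D_j^-}w_{j'}(r_j)$. Table $T^+$: if $\alpha_j^+\ge w_jp_j/\epsilon$, $j$ is assigned to the bucket $(\lfloor\alpha_j^+/w_j\rfloor_2,\lfloor w_j\rfloor_2)$ of $T^+$ (and put in the set $J^+$); in each bucket of $T^+$, the first job assigned to it is rejected, and then every $(1/\epsilon)$-th subsequent job assigned to it. Table $T^-$: if $\alpha_j^->w_jp_j/\epsilon$, $j$ is assigned to the bucket $(\lfloor\alpha_j^-\rfloor_2,\lfloor\rho_j\rfloor_2,\lfloor p_j\rfloor_2)$ of $T^-$ (and put in $J^-$); in each bucket of $T^-$, every $(1/\epsilon)$-th job assigned to it is rejected (the first rejected one being the $(1/\epsilon)$-th). A job may be assigned to both tables. $J^{imm}$ is the set of jobs rejected upon arrival by this rule. The constant in $O(\cdot)$ is absolute. *)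

theory Defs
  imports Complex_Main
begin

definition floor2 :: "real \<Rightarrow> int" where
  "floor2 x = (GREATEST i. 2 powi i \<le> x)"

lemma floor2_unique:
  assumes "2 powi i \<le> x" "x < 2 powi (i + 1)"
  shows "floor2 x = i"
  unfolding floor2_def
proof (rule Greatest_equality)
  fix k :: int assume "2 powi k \<le> x"
  with assms(2) have "(2::real) powi k < 2 powi (i + 1)" by linarith
  then show "k \<le> i"
    by (metis int_less_real_le linorder_not_le one_le_numeral power_int_increasing zle_add1_eq_le)
qed (fact assms(1))

lemma floor2_eq_floor_log:
  assumes "0 < x"
  shows "floor2 x = \<lfloor>log 2 x\<rfloor>"
proof (rule floor2_unique)
  have *: "(2::real) powi k = 2 powr of_int k" for k
    by (simp add: powr_real_of_int')
  have "(2::real) powr of_int \<lfloor>log 2 x\<rfloor> \<le> 2 powr log 2 x"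
    by (intro powr_mono) auto
  then show "2 powi \<lfloor>log 2 x\<rfloor> \<le> x" using assms by (simp add: *)
  have "(2::real) powr log 2 x < 2 powr of_int (\<lfloor>log 2 x\<rfloor> + 1)"
    by (intro powr_less_mono) linarith+
  then show "x < 2 powi (\<lfloor>log 2 x\<rfloor> + 1)" using assms by (simp only: *) simp
qed

text \<open>
  \<open>(i, j) \<in> tie\<close> means that, if \<open>i\<close> and \<open>j\<close> arrive simultaneously, \<open>i\<close> is considered before \<open>j\<close>.
  A constant that is to be absolute must not depend on the type of jobs either; such statements
  instantiate it to \<open>nat\<close>, which is enough to name the jobs of any finite instance.
\<close>

locale online_instance =
  fixes J :: "'j set"
    and r :: "'j \<Rightarrow> int"
    and p :: "'j \<Rightarrow> nat"
    and w :: "'j \<Rightarrow> real"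
    and tie :: "'j rel"
    and \<epsilon> :: real
  assumes finite_jobs: "finite J"
    and size_pos: "j \<in> J \<Longrightarrow> 0 < p j"
    and weight_pos: "j \<in> J \<Longrightarrow> 0 < w j"
    and tie_order: "strict_linear_order_on J tie"
    and eps_pos: "0 < \<epsilon>"
    and eps_small: "\<epsilon>\<^sup>2 \<le> 1 / 2"
    and eps_recip: "1 / \<epsilon> \<in> \<int>"
begin

definition density :: "'j \<Rightarrow> real" where
  "density j = w j / p j"

definition before :: "'j \<Rightarrow> 'j \<Rightarrow> bool" where
  "before i j \<longleftrightarrow> r i < r j \<or> (r i = r j \<and> (i, j) \<in> tie)"

definition K :: nat where
  "K = nat \<lfloor>1 / \<epsilon>\<rfloor>"

end

text \<open>
  A trace of the single machine: \<open>proc t\<close> is the job processed in the slot \<open>[t, t+1]\<close> (\<open>None\<close> if the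
  machine idles), \<open>Jimm\<close> is the set of jobs rejected on arrival, and \<open>L t\<close> is the set \<open>L\<close> after
  step (2) at time \<open>t\<close>. Which traces are produced by the algorithm is fixed by the locale
  \<open>algorithm_run\<close> below.
\<close>

locale trace = online_instance J r p w tie \<epsilon>
  for J :: "'j set" and r p w tie \<epsilon> +
  fixes proc :: "int \<Rightarrow> 'j option"
    and Jimm :: "'j set"
    and L :: "int \<Rightarrow> 'j set"
begin

definition rem_time :: "'j \<Rightarrow> int \<Rightarrow> nat" where
  "rem_time j t = p j - card {s. r j \<le> s \<and> s < t \<and> proc s = Some j}"

definition rem_weight :: "'j \<Rightarrow> int \<Rightarrow> real" where
  "rem_weight j t = density j * rem_time j t"

text \<open>A rejected job is rejected at its release time, so it is never active.\<close>

definition active :: "int \<Rightarrow> 'j set" where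
  "active t = {j \<in> J. r j \<le> t \<and> 0 < rem_time j t \<and> j \<notin> Jimm}"

text \<open>\<open>A(r\<^sub>j)\<close>, as seen when the arriving job \<open>j\<close> is considered.\<close>

definition active_at_arrival :: "'j \<Rightarrow> 'j set" where
  "active_at_arrival j = {j' \<in> active (r j). before j' j}"

definition D_plus :: "'j \<Rightarrow> 'j set" where
  "D_plus j = {j' \<in> active_at_arrival j. floor2 (density j') \<ge> floor2 (density j)}"

definition D_minus :: "'j \<Rightarrow> 'j set" where
  "D_minus j = active_at_arrival j - D_plus j"

definition \<alpha>_plus :: "'j \<Rightarrow> real" where
  "\<alpha>_plus j =
     w j * (\<Sum>j' \<in> {j' \<in> D_plus j. density j' \<ge> density j}. real (rem_time j' (r j))) +
     p j * (\<Sum>j' \<in> {j' \<in> D_plus j. density j' < density j}. rem_weight j' (r j))"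

definition \<alpha>_minus :: "'j \<Rightarrow> real" where
  "\<alpha>_minus j = p j * (\<Sum>j' \<in> D_minus j. rem_weight j' (r j))"

definition J_plus :: "'j set" where
  "J_plus = {j \<in> J. \<alpha>_plus j \<ge> w j * p j / \<epsilon>}"

definition J_minus :: "'j set" where
  "J_minus = {j \<in> J. \<alpha>_minus j > w j * p j / \<epsilon>}"

definition bucket_plus :: "'j \<Rightarrow> int \<times> int" where
  "bucket_plus j = (floor2 (\<alpha>_plus j / w j), floor2 (w j))"

definition bucket_minus :: "'j \<Rightarrow> int \<times> int \<times> int" where
  "bucket_minus j = (floor2 (\<alpha>_minus j), floor2 (density j), floor2 (p j))"

text \<open>
  The number of jobs assigned to the bucket of \<open>j\<close> before \<open>j\<close> itself. Rejected jobs are counted too: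
  assignment to a bucket does not depend on the outcome.
\<close>

definition index_plus :: "'j \<Rightarrow> nat" where
  "index_plus j = card {i \<in> J_plus. before i j \<and> bucket_plus i = bucket_plus j}"

definition index_minus :: "'j \<Rightarrow> nat" where
  "index_minus j = card {i \<in> J_minus. before i j \<and> bucket_minus i = bucket_minus j}"

text \<open>
  A bucket of \<open>T\<^sup>+\<close> rejects its jobs number \<open>1, 1 + K, 1 + 2K, \<dots>\<close>, a bucket of \<open>T\<^sup>-\<close> its jobs
  number \<open>K, 2K, \<dots>\<close>; the indices above count from \<open>0\<close>.
\<close>

definition rejected_plus :: "'j set" where
  "rejected_plus = {j \<in> J_plus. K dvd index_plus j}"

definition rejected_minus :: "'j set" where
  "rejected_minus = {j \<in> J_minus. K dvd Suc (index_minus j)}"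

definition starts_at :: "'j \<Rightarrow> int \<Rightarrow> bool" where
  "starts_at j t' \<longleftrightarrow> proc t' = Some j \<and> (\<forall>s < t'. proc s \<noteq> Some j)"

text \<open>
  The jobs added to \<open>L\<close> at time \<open>t\<close>. When several jobs arrive at \<open>t\<close>, performing the test after each
  of them has the same effect as performing it once after the last one, since weights are positive.
  The arrivals in \<open>(t', t]\<close> include the immediately rejected ones. The test is also applied to a
  job that finishes at \<open>t\<close>: such a job counts as having entered \<open>L\<close>, and it leaves \<open>L\<close> at once.
\<close>

definition enters_L :: "int \<Rightarrow> 'j set" where
  "enters_L t = {j. proc (t - 1) = Some j \<and> j \<notin> L (t - 1) \<and>
     (\<exists>t'. starts_at j t' \<and> (\<Sum>i \<in> {i \<in> J. t' < r i \<and> r i \<le> t}. w i) > w j / \<epsilon>)}"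

definition ever_L :: "'j set" where
  "ever_L = (\<Union>t. enters_L t)"

definition must_continue :: "int \<Rightarrow> 'j \<Rightarrow> bool" where
  "must_continue t j \<longleftrightarrow> proc (t - 1) = Some j \<and> 0 < rem_time j t \<and> j \<notin> L t"

end

text \<open>
  Time ranges over all integers, so \<open>idle\<close> and \<open>L_init\<close> are needed as initial conditions: without
  them, \<open>L\<close> or an uninterrupted processing could extend to \<open>-\<infinity>\<close>. All other conditions determine the state
  from the past, up to the choice among active jobs of equal highest density, which is left open.
\<close>

locale algorithm_run = trace J r p w tie \<epsilon> proc Jimm L
  for J :: "'j set" and r p w tie \<epsilon> proc Jimm L +
  assumes idle: "(\<forall>j \<in> J. t < r j) \<Longrightarrow> proc t = None"
    and L_init: "(\<forall>j \<in> J. t < r j) \<Longrightarrow> L t = {}"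
    and reject: "Jimm = rejected_plus \<union> rejected_minus"
    and L_step: "L t = {j \<in> L (t - 1) \<union> enters_L t. 0 < rem_time j t}"
    and continue_job: "must_continue t j \<Longrightarrow> proc t = Some j"
    and choose_job: "\<not> (\<exists>j. must_continue t j) \<Longrightarrow>
      (case proc t of
         None \<Rightarrow> active t = {}
       | Some j \<Rightarrow> j \<in> active t \<and> (\<forall>i \<in> active t. density i \<le> density j))"

end

theory Submission
  imports Defs
begin

text \<open>
  A bucket rejects at most one in \<open>1/\<epsilon>\<close> of its jobs, whose weights agree up to a constant factor,
  so only the first rejections in the buckets of \<open>T\<^sup>+\<close> need an argument. Within a row \<open>a\<close> of \<open>T\<^sup>+\<close>
  the weights of the buckets are geometric, hence dominated by the heaviest first job \<open>j\<^sub>a\<close>. The jobs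
  of density at least \<open>\<theta>\<^sub>a = \<rho> j\<^sub>a / 2\<close> have total size at least \<open>2\<^sup>a\<close>, and \<open>w j\<^sub>a \<le> 4 \<epsilon> 2\<^sup>a \<theta>\<^sub>a\<close>.
  How these jobs came to be active does not matter: arranging all jobs by decreasing density, the
  one at volume position \<open>2\<^sup>a\<close> has density at least \<open>\<theta>\<^sub>a\<close>, so \<open>\<Sum> 2\<^sup>a \<theta>\<^sub>a\<close> is at most twice
  the total weight. Finally, a job entering \<open>L\<close> is paid for by the jobs arriving while it is
  processed without interruption, and these sets of jobs are disjoint.
\<close>

section \<open>Rounding to powers of two, and sums over dyadic levels\<close>

lemma powi_2_eq_powr: "(2::real) powi k = 2 powr of_int k"
  by (simp add: powr_real_of_int')

lemma floor2_le: "0 < x \<Longrightarrow> 2 powi floor2 x \<le> x"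
  using powr_mono[of "of_int \<lfloor>log 2 x\<rfloor>" "log 2 x" 2]
  by (simp add: floor2_eq_floor_log powi_2_eq_powr)

lemma less_floor2: "0 < x \<Longrightarrow> x < 2 * 2 powi floor2 x"
proof -
  assume x: "0 < x"
  have "(2::real) powr log 2 x < 2 powr (1 + of_int \<lfloor>log 2 x\<rfloor>)"
    by (intro powr_less_mono) linarith+
  then show ?thesis using x by (simp add: floor2_eq_floor_log powi_2_eq_powr powr_add)
qed

text \<open>Used in both directions inside a bucket, where the rounded quantities then agree up to a
  factor of 2, and in one direction for \<open>D_plus\<close>, whose jobs are more than half as
  dense as the arriving one.\<close>

lemma floor2_le_imp_less_double:
  assumes "0 < x" "0 < y" "floor2 x \<le> floor2 y"
  shows "x < 2 * y"
proof -
  have "x < 2 * 2 powi floor2 x" using assms(1) by (rule less_floor2)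
  also have "\<dots> \<le> 2 * 2 powi floor2 y" using assms(3) by (simp add: power_int_increasing)
  also have "\<dots> \<le> 2 * y" using floor2_le[OF assms(2)] by simp
  finally show ?thesis .
qed

lemma sum_powi_2_le:
  fixes B :: "int set"
  assumes "finite B" "\<And>b. b \<in> B \<Longrightarrow> b \<le> m"
  shows "(\<Sum>b\<in>B. 2 powi b) \<le> (2 * 2 powi m :: real)"
  using assms
proof (induction B arbitrary: m rule: finite_linorder_max_induct)
  case empty
  then show ?case by simp
next
  case (insert b A)
  \<comment> \<open>The remaining exponents are at most \<open>b - 1\<close>, so together they
    contribute no more than \<open>b\<close> alone.\<close>
  have "(\<Sum>i\<in>A. 2 powi i) \<le> (2 * 2 powi (b - 1) :: real)"
    using insert.IH[of "b - 1"] insert.hyps by force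
  also have "\<dots> = 2 powi b" by (simp add: power_int_diff)
  finally have "(\<Sum>i\<in>insert b A. 2 powi i) \<le> (2 * 2 powi b :: real)"
    using insert.hyps by (subst sum.insert) auto
  also have "\<dots> \<le> 2 * 2 powi m"
    using insert.prems[of b] by (simp add: power_int_increasing)
  finally show ?case .
qed

text \<open>
  This is the layer-cake formula for the density, integrated from the lowest threshold upwards: the
  induction step removes the layer below the smallest \<open>\<theta> a\<close>.
\<close>

lemma sum_powi_threshold_le:
  fixes \<theta> \<rho> :: "_ \<Rightarrow> real" and q :: "_ \<Rightarrow> real" and A :: "int set"
  assumes "finite A" "finite J" "\<And>j. j \<in> J \<Longrightarrow> 0 \<le> q j" "\<And>j. j \<in> J \<Longrightarrow> 0 \<le> \<rho> j"
    and "\<And>a. a \<in> A \<Longrightarrow> 0 \<le> \<theta> a"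
    and "\<And>a. a \<in> A \<Longrightarrow> 2 powi a \<le> (\<Sum>j | j \<in> J \<and> \<theta> a \<le> \<rho> j. q j)"
  shows "(\<Sum>a\<in>A. 2 powi a * \<theta> a) \<le> 2 * (\<Sum>j\<in>J. q j * \<rho> j)"
  using assms(1,4,5,6)
proof (induction "card A" arbitrary: A \<theta> \<rho>)
  case 0
  then show ?case using assms(3) by (simp add: sum_nonneg)
next
  case (Suc n)
  have ne: "A \<noteq> {}" using Suc.hyps(2) by auto
  obtain m where m: "m \<in> A" "\<And>a. a \<in> A \<Longrightarrow> \<theta> m \<le> \<theta> a"
    using arg_min_if_finite(1)[OF Suc.prems(1) ne, of \<theta>] arg_min_least[OF Suc.prems(1) ne, of _ \<theta>]
    by blast
  \<comment> \<open>Truncation at 0 keeps the shifted values nonnegative, as the induction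
    hypothesis demands; a job reaching \<open>\<theta> a\<close> still reaches the shifted
    threshold.\<close>
  define \<rho>' where "\<rho>' j = max 0 (\<rho> j - \<theta> m)" for j
  let ?b = "Max A"
  have b: "?b \<in> A" using Suc.prems(1) ne by simp
  have IH: "(\<Sum>a\<in>A - {m}. 2 powi a * (\<theta> a - \<theta> m)) \<le> 2 * (\<Sum>j\<in>J. q j * \<rho>' j)"
  proof (rule Suc.hyps(1))
    show "n = card (A - {m})" using Suc.hyps(2) m(1) Suc.prems(1) by simp
    fix a assume a: "a \<in> A - {m}"
    show "0 \<le> \<theta> a - \<theta> m" using m(2) a by simp
    have "2 powi a \<le> (\<Sum>j | j \<in> J \<and> \<theta> a \<le> \<rho> j. q j)" using Suc.prems(4) a by simp
    also have "\<dots> \<le> (\<Sum>j | j \<in> J \<and> \<theta> a - \<theta> m \<le> \<rho>' j. q j)"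
      by (rule sum_mono2) (use assms(2,3) in \<open>auto simp: \<rho>'_def\<close>)
    finally show "2 powi a \<le> (\<Sum>j | j \<in> J \<and> \<theta> a - \<theta> m \<le> \<rho>' j. q j)" .
  qed (use Suc.prems(1) in \<open>auto simp: \<rho>'_def\<close>)
  \<comment> \<open>The layer below \<open>\<theta> m\<close> counts every level of
    \<open>A\<close>, but the geometric sum is paid for by the volume of the largest level alone,
    and that volume also lies above the lower threshold \<open>\<theta> m\<close>.\<close>
  have "(\<Sum>a\<in>A. 2 powi a) \<le> (2 * 2 powi ?b :: real)"
    using Suc.prems(1) by (intro sum_powi_2_le) auto
  also have "2 powi ?b \<le> (\<Sum>j | j \<in> J \<and> \<theta> ?b \<le> \<rho> j. q j)" using Suc.prems(4) b by blast
  also have "\<dots> \<le> (\<Sum>j | j \<in> J \<and> \<theta> m \<le> \<rho> j. q j)"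
    by (rule sum_mono2) (use assms(2,3) m(2)[OF b] in auto)
  also have "\<dots> = (\<Sum>j\<in>J. if \<theta> m \<le> \<rho> j then q j else 0)"
    using assms(2) by (simp add: sum.inter_filter)
  finally have layer: "(\<Sum>a\<in>A. 2 powi a) \<le> 2 * (\<Sum>j\<in>J. if \<theta> m \<le> \<rho> j then q j else 0)" by simp
  have "(\<Sum>a\<in>A. 2 powi a * \<theta> a)
      = (\<Sum>a\<in>A. 2 powi a * (\<theta> a - \<theta> m)) + \<theta> m * (\<Sum>a\<in>A. 2 powi a)"
    by (simp add: sum_distrib_left algebra_simps flip: sum.distrib)
  \<comment> \<open>The summand of \<open>m\<close> is zero, so the induction over the smaller set
    loses nothing.\<close>
  also have "(\<Sum>a\<in>A. 2 powi a * (\<theta> a - \<theta> m)) = (\<Sum>a\<in>A - {m}. 2 powi a * (\<theta> a - \<theta> m))"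
    using Suc.prems(1) m(1) by (simp add: sum.remove)
  also have "\<dots> + \<theta> m * (\<Sum>a\<in>A. 2 powi a)
      \<le> 2 * (\<Sum>j\<in>J. q j * \<rho>' j) + \<theta> m * (2 * (\<Sum>j\<in>J. if \<theta> m \<le> \<rho> j then q j else 0))"
    using IH layer Suc.prems(3)[OF m(1)] by (intro add_mono mult_left_mono)
  also have "\<dots> = 2 * (\<Sum>j\<in>J. q j * \<rho>' j + \<theta> m * (if \<theta> m \<le> \<rho> j then q j else 0))"
    by (simp add: sum.distrib sum_distrib_left algebra_simps)
  \<comment> \<open>For each job, the two layers add up to exactly \<open>q j * \<rho> j\<close> if
    \<open>\<theta> m \<le> \<rho> j\<close>, and to 0 otherwise.\<close>
  also have "\<dots> \<le> 2 * (\<Sum>j\<in>J. q j * \<rho> j)"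
    by (intro mult_left_mono sum_mono)
      (use assms(3) Suc.prems(2) in \<open>auto simp: \<rho>'_def algebra_simps max_def\<close>)
  finally show ?case .
qed

section \<open>The weight of every \<open>K\<close>-th job of a bucket\<close>

lemma card_multiples_le: "K * card {m \<in> {1..n}. K dvd m} \<le> n" for K n :: nat
proof (cases "K = 0")
  case False
  have "inj_on (\<lambda>m. m div K) {m \<in> {1..n}. K dvd m}"
    by (auto simp: inj_on_def dvd_def)
  moreover have "(\<lambda>m. m div K) ` {m \<in> {1..n}. K dvd m} \<subseteq> {1..n div K}"
    using False by (auto simp: div_le_mono dvd_imp_le div_greater_zero_iff Suc_le_eq)
  ultimately have "card {m \<in> {1..n}. K dvd m} \<le> n div K"
    by (metis card_inj_on_le card_atLeastAtMost diff_Suc_1 finite_atLeastAtMost)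
  then have "K * card {m \<in> {1..n}. K dvd m} \<le> K * (n div K)" by (rule mult_le_mono2)
  also have "\<dots> \<le> n" by simp
  finally show ?thesis .
qed simp

text \<open>In each class the positions \<open>g\<close> of the chosen elements are distinct
  multiples of \<open>K\<close> between 1 and the class size, so at most one element in
  \<open>K\<close> is chosen. Starting at 1 matters: position 0 would be a choice that no
  \<open>K\<close> elements pay for.\<close>

lemma sum_every_Kth_le:
  fixes w :: "'a \<Rightarrow> real" and g :: "'a \<Rightarrow> nat"
  assumes "finite A" "R \<subseteq> A" "0 \<le> c"
    and w_nonneg: "\<And>j. j \<in> A \<Longrightarrow> 0 \<le> w j"
    and w: "\<And>i j. i \<in> A \<Longrightarrow> j \<in> A \<Longrightarrow> f i = f j \<Longrightarrow> w i \<le> c * w j"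
    and g: "\<And>j. j \<in> R \<Longrightarrow> K dvd g j \<and> 1 \<le> g j \<and> g j \<le> card {i \<in> A. f i = f j}"
    and inj: "\<And>i j. i \<in> R \<Longrightarrow> j \<in> R \<Longrightarrow> f i = f j \<Longrightarrow> g i = g j \<Longrightarrow> i = j"
  shows "real K * (\<Sum>j\<in>R. w j) \<le> c * (\<Sum>j\<in>A. w j)"
proof -
  have fR: "finite R" using assms(1,2) finite_subset by blast
  have one: "real K * (\<Sum>j | j \<in> R \<and> f j = b. w j) \<le> c * (\<Sum>j | j \<in> A \<and> f j = b. w j)"
    if "b \<in> f ` A" for b
  proof -
    define B where "B = {j \<in> A. f j = b}"
    define S where "S = {j \<in> R. f j = b}"
    have fB: "finite B" using assms(1) by (simp add: B_def)
    have SB: "S \<subseteq> B" using assms(2) by (auto simp: S_def B_def)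
    have neB: "B \<noteq> {}" using that by (auto simp: B_def)
    \<comment> \<open>The lightest element is the common yardstick: chosen weights are at most
      \<open>c * w k\<close>, and all weights are at least \<open>w k\<close>.\<close>
    obtain k where k: "k \<in> B" "\<And>j. j \<in> B \<Longrightarrow> w k \<le> w j"
      using arg_min_if_finite(1)[OF fB neB, of w] arg_min_least[OF fB neB, of _ w] by blast
    have nonneg: "0 \<le> c * w k"
      using w_nonneg[of k] k(1) \<open>0 \<le> c\<close> by (simp add: B_def)
    have "card S \<le> card {m \<in> {1..card B}. K dvd m}"
    proof (rule card_inj_on_le)
      show "inj_on g S" using inj by (auto simp: inj_on_def S_def)
      show "g ` S \<subseteq> {m \<in> {1..card B}. K dvd m}" using g by (force simp: S_def B_def)
    qed simp
    then have card: "K * card S \<le> card B"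
      using card_multiples_le[of K "card B"] mult_le_mono2 le_trans by blast
    have "(\<Sum>j\<in>S. w j) \<le> (\<Sum>j\<in>S. c * w k)"
      using k(1) SB w by (intro sum_mono) (auto simp: B_def)
    then have "real K * (\<Sum>j\<in>S. w j) \<le> real K * (real (card S) * (c * w k))"
      by (intro mult_left_mono) auto
    also have "\<dots> = real (K * card S) * (c * w k)" by simp
    also have "\<dots> \<le> real (card B) * (c * w k)"
      using card nonneg by (intro mult_right_mono) (use of_nat_mono in blast)+
    also have "\<dots> = c * (\<Sum>j\<in>B. w k)" by simp
    also have "\<dots> \<le> c * (\<Sum>j\<in>B. w j)"
      using k(2) \<open>0 \<le> c\<close> by (intro mult_left_mono sum_mono) auto
    finally show ?thesis by (simp add: S_def B_def)
  qed
  have "real K * (\<Sum>j\<in>R. w j) = (\<Sum>b\<in>f ` A. real K * (\<Sum>j | j \<in> R \<and> f j = b. w j))"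
    using sum.group[OF fR finite_imageI[OF assms(1)], of f f w] assms(2)
    by (simp add: image_mono flip: sum_distrib_left)
  also have "\<dots> \<le> (\<Sum>b\<in>f ` A. c * (\<Sum>j | j \<in> A \<and> f j = b. w j))"
    using one by (rule sum_mono)
  also have "\<dots> = c * (\<Sum>j\<in>A. w j)"
    using sum.group[OF assms(1) finite_imageI[OF assms(1)], of f f w]
    by (simp flip: sum_distrib_left)
  finally show ?thesis .
qed

section \<open>Arrival order and ranks within a bucket\<close>

context online_instance
begin

lemma real_K: "real K = 1 / \<epsilon>"
proof -
  obtain k where k: "1 / \<epsilon> = of_int k" using eps_recip by (auto elim: Ints_cases)
  moreover have "0 < 1 / \<epsilon>" using eps_pos by simp
  ultimately have "0 < k" by simp
  with k show ?thesis by (simp add: K_def)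
qed

lemma before_trans: "before i j \<Longrightarrow> before j k \<Longrightarrow> before i k"
  using tie_order unfolding before_def strict_linear_order_on_def by (auto dest: transD)

lemma before_irrefl: "\<not> before i i"
  using tie_order unfolding before_def strict_linear_order_on_def by (simp add: irrefl_def)

lemma before_total: "i \<in> J \<Longrightarrow> j \<in> J \<Longrightarrow> i = j \<or> before i j \<or> before j i"
  using tie_order unfolding before_def strict_linear_order_on_def total_on_def
  by (metis linorder_cases)

lemma rank_less:
  assumes "finite A" "i \<in> A" "f i = f j" "before i j"
  shows "card {k \<in> A. before k i \<and> f k = f i} < card {k \<in> A. before k j \<and> f k = f j}"
proof (rule psubset_card_mono)
  have "i \<in> {k \<in> A. before k j \<and> f k = f j}" using assms by simp
  moreover have "i \<notin> {k \<in> A. before k i \<and> f k = f i}" using before_irrefl by simp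
  ultimately show "{k \<in> A. before k i \<and> f k = f i} \<subset> {k \<in> A. before k j \<and> f k = f j}"
    using assms before_trans by auto
qed (use assms in simp)

text \<open>The arrival order is total and the rank strictly increases along it within a class, so
  the rank identifies a job of its bucket.\<close>

lemma rank_inj:
  assumes "A \<subseteq> J" "i \<in> A" "j \<in> A" "f i = f j"
    and "card {k \<in> A. before k i \<and> f k = f i} = card {k \<in> A. before k j \<and> f k = f j}"
  shows "i = j"
proof (rule ccontr)
  have "finite A" using assms(1) finite_jobs finite_subset by blast
  moreover assume "i \<noteq> j"
  then have "before i j \<or> before j i" using before_total assms(1-3) by blast
  ultimately show False
    using rank_less[of A i f j] rank_less[of A j f i] assms(2-5) by auto
qed

text \<open>Strict because no job precedes itself; this leaves room for the position
  \<open>Suc (index_minus j)\<close>.\<close>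

lemma rank_less_card:
  assumes "finite A" "j \<in> A"
  shows "card {k \<in> A. before k j \<and> f k = f j} < card {k \<in> A. f k = f j}"
  by (rule psubset_card_mono) (use assms before_irrefl[of j] in auto)

lemma density_pos: "j \<in> J \<Longrightarrow> 0 < density j"
  by (simp add: density_def size_pos weight_pos)

lemma weight_eq: "j \<in> J \<Longrightarrow> w j = p j * density j"
  using size_pos[of j] by (simp add: density_def)

end

section \<open>The weight rejected by each of the two tables\<close>

context trace
begin

lemma rem_time_le: "rem_time j t \<le> p j"
  by (simp add: rem_time_def)

lemma rem_time_antimono: "s \<le> t \<Longrightarrow> rem_time j t \<le> rem_time j s"
  unfolding rem_time_def
proof (rule diff_le_mono2, rule card_mono)
  show "finite {u. r j \<le> u \<and> u < t \<and> proc u = Some j}"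
    by (rule finite_subset[of _ "{r j..<t}"]) auto
qed auto

lemma finite_J_plus: "finite J_plus" and J_plus_subset: "J_plus \<subseteq> J"
  using finite_jobs by (auto simp: J_plus_def)

lemma finite_J_minus: "finite J_minus" and J_minus_subset: "J_minus \<subseteq> J"
  using finite_jobs by (auto simp: J_minus_def)

text \<open>The factor 4 is 2 * 2: inside a bucket, density and size each vary by at most a factor
  of 2, and the weight is their product.\<close>

lemma weight_rejected_minus: "(\<Sum>j\<in>rejected_minus. w j) \<le> 4 * \<epsilon> * (\<Sum>j\<in>J. w j)"
proof -
  have "real K * (\<Sum>j\<in>rejected_minus. w j) \<le> 4 * (\<Sum>j\<in>J_minus. w j)"
  proof (rule sum_every_Kth_le[where f = bucket_minus and g = "\<lambda>j. Suc (index_minus j)"])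
    fix i j assume "i \<in> J_minus" "j \<in> J_minus" and b: "bucket_minus i = bucket_minus j"
    then have ij: "i \<in> J" "j \<in> J" using J_minus_subset by auto
    have "density i \<le> 2 * density j" "real (p i) \<le> 2 * real (p j)"
      using b ij density_pos size_pos
      by (auto simp: bucket_minus_def intro!: less_imp_le[OF floor2_le_imp_less_double])
    then have "real (p i) * density i \<le> (2 * real (p j)) * (2 * density j)"
      using density_pos[OF ij(1)] by (intro mult_mono) auto
    then show "w i \<le> 4 * w j" using ij by (simp add: weight_eq)
  next
    fix j assume "j \<in> rejected_minus"
    then show "K dvd Suc (index_minus j) \<and> 1 \<le> Suc (index_minus j) \<and>
        Suc (index_minus j) \<le> card {i \<in> J_minus. bucket_minus i = bucket_minus j}"
      using rank_less_card[OF finite_J_minus, of j bucket_minus]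
      by (simp add: rejected_minus_def index_minus_def Suc_le_eq)
  next
    fix i j assume "i \<in> rejected_minus" "j \<in> rejected_minus"
      "bucket_minus i = bucket_minus j" "Suc (index_minus i) = Suc (index_minus j)"
    then show "i = j"
      using rank_inj[OF J_minus_subset, of i j bucket_minus]
      by (simp add: rejected_minus_def index_minus_def)
  next
    fix j assume "j \<in> J_minus"
    then show "0 \<le> w j" using J_minus_subset weight_pos less_imp_le by blast
  qed (auto simp: finite_J_minus rejected_minus_def)
  also have "(\<Sum>j\<in>J_minus. w j) \<le> (\<Sum>j\<in>J. w j)"
    using finite_jobs J_minus_subset weight_pos by (intro sum_mono2) (auto simp: less_imp_le)
  finally show ?thesis using eps_pos by (simp add: real_K field_simps)
qed

text \<open>Once index 0 is set aside, the zero-based indices of rejected jobs are positive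
  multiples of \<open>K\<close> and serve directly as positions. The factor 2 is the width of a
  weight class.\<close>

lemma weight_rejected_plus_later:
  "(\<Sum>j | j \<in> rejected_plus \<and> index_plus j \<noteq> 0. w j) \<le> 2 * \<epsilon> * (\<Sum>j\<in>J. w j)"
proof -
  have "real K * (\<Sum>j | j \<in> rejected_plus \<and> index_plus j \<noteq> 0. w j) \<le> 2 * (\<Sum>j\<in>J_plus. w j)"
  proof (rule sum_every_Kth_le[where f = bucket_plus and g = index_plus])
    fix i j assume "i \<in> J_plus" "j \<in> J_plus" and "bucket_plus i = bucket_plus j"
    then show "w i \<le> 2 * w j"
      using weight_pos J_plus_subset
      by (auto simp: bucket_plus_def intro!: less_imp_le[OF floor2_le_imp_less_double])
  next
    fix j assume "j \<in> {j. j \<in> rejected_plus \<and> index_plus j \<noteq> 0}"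
    then show "K dvd index_plus j \<and> 1 \<le> index_plus j \<and>
        index_plus j \<le> card {i \<in> J_plus. bucket_plus i = bucket_plus j}"
      using rank_less_card[OF finite_J_plus, of j bucket_plus]
      by (simp add: rejected_plus_def index_plus_def)
  next
    fix i j assume "i \<in> {j. j \<in> rejected_plus \<and> index_plus j \<noteq> 0}"
      "j \<in> {j. j \<in> rejected_plus \<and> index_plus j \<noteq> 0}"
      "bucket_plus i = bucket_plus j" "index_plus i = index_plus j"
    then show "i = j"
      using rank_inj[OF J_plus_subset, of i j bucket_plus]
      by (simp add: rejected_plus_def index_plus_def)
  next
    fix j assume "j \<in> J_plus"
    then show "0 \<le> w j" using J_plus_subset weight_pos less_imp_le by blast
  qed (auto simp: finite_J_plus rejected_plus_def)
  also have "(\<Sum>j\<in>J_plus. w j) \<le> (\<Sum>j\<in>J. w j)"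
    using finite_jobs J_plus_subset weight_pos by (intro sum_mono2) (auto simp: less_imp_le)
  finally show ?thesis using eps_pos by (simp add: real_K field_simps)
qed

text \<open>A less dense job \<open>i\<close> of \<open>D_plus j\<close> contributes
  \<open>p j * density i\<close> per unit of remaining time, at most
  \<open>p j * density j = w j\<close>, which is the rate of the denser ones. Enlarging remaining
  times to full sizes makes the bound independent of the schedule.\<close>

lemma \<alpha>_plus_le_volume:
  assumes "j \<in> J"
  shows "\<alpha>_plus j / w j \<le> (\<Sum>i | i \<in> J \<and> density j / 2 \<le> density i. real (p i))"
proof -
  have D: "D_plus j \<subseteq> {i \<in> J. density j / 2 \<le> density i}"
    using floor2_le_imp_less_double density_pos assms
    by (force simp: D_plus_def active_at_arrival_def active_def)
  then have fin: "finite (D_plus j)" using finite_jobs finite_subset by fastforce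
  have "p j * (\<Sum>i \<in> {i \<in> D_plus j. density i < density j}. rem_weight i (r j))
      \<le> p j * (\<Sum>i \<in> {i \<in> D_plus j. density i < density j}. density j * rem_time i (r j))"
    by (intro mult_left_mono sum_mono) (auto simp: rem_weight_def intro!: mult_right_mono)
  also have "\<dots> = w j * (\<Sum>i \<in> {i \<in> D_plus j. density i < density j}. real (rem_time i (r j)))"
    using assms by (simp add: weight_eq sum_distrib_left mult.assoc)
  finally have "\<alpha>_plus j \<le> w j * ((\<Sum>i \<in> {i \<in> D_plus j. density i \<ge> density j}. real (rem_time i (r j)))
      + (\<Sum>i \<in> {i \<in> D_plus j. density i < density j}. real (rem_time i (r j))))"
    by (simp add: \<alpha>_plus_def distrib_left)
  also have "(\<Sum>i \<in> {i \<in> D_plus j. density i \<ge> density j}. real (rem_time i (r j)))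
      + (\<Sum>i \<in> {i \<in> D_plus j. density i < density j}. real (rem_time i (r j)))
      = (\<Sum>i \<in> D_plus j. real (rem_time i (r j)))"
    using fin by (subst sum.union_disjoint[symmetric]) (auto intro!: sum.cong)
  finally have "\<alpha>_plus j / w j \<le> (\<Sum>i \<in> D_plus j. real (rem_time i (r j)))"
    using weight_pos[OF assms] by (simp add: field_simps)
  also have "\<dots> \<le> (\<Sum>i \<in> D_plus j. real (p i))" by (intro sum_mono) (simp add: rem_time_le)
  also have "\<dots> \<le> (\<Sum>i | i \<in> J \<and> density j / 2 \<le> density i. real (p i))"
    using D finite_jobs by (intro sum_mono2) auto
  finally show ?thesis .
qed

text \<open>The constant is 4 * 4 * 2: a row against its representative job, that job against its
  level times threshold, and the layer-cake bound.\<close>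

lemma weight_rejected_plus_first:
  "(\<Sum>j | j \<in> rejected_plus \<and> index_plus j = 0. w j) \<le> 32 * \<epsilon> * (\<Sum>j\<in>J. w j)"
proof -
  define F where "F = {j. j \<in> rejected_plus \<and> index_plus j = 0}"
  have FJp: "F \<subseteq> J_plus" by (auto simp: F_def rejected_plus_def)
  then have FJ: "F \<subseteq> J" using J_plus_subset by blast
  have fin: "finite F" using FJ finite_jobs finite_subset by blast
  define row where "row j = floor2 (\<alpha>_plus j / w j)" for j
  \<comment> \<open>Two first jobs of one row and one weight class share bucket and rank 0. Hence
    the weight classes within a row are distinct, and their powers of two form a geometric
    sum.\<close>
  have inj: "i = j" if "i \<in> F" "j \<in> F" "row i = row j" "floor2 (w i) = floor2 (w j)" for i j
  proof (rule rank_inj[OF J_plus_subset, of i j bucket_plus])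
    show "i \<in> J_plus" "j \<in> J_plus" using that FJp by auto
    show "bucket_plus i = bucket_plus j" using that by (simp add: bucket_plus_def row_def)
    show "card {k \<in> J_plus. before k i \<and> bucket_plus k = bucket_plus i}
        = card {k \<in> J_plus. before k j \<and> bucket_plus k = bucket_plus j}"
      using that(1,2) unfolding F_def index_plus_def by simp
  qed
  have "\<exists>m. m \<in> F \<and> row m = a \<and> (\<Sum>j | j \<in> F \<and> row j = a. w j) \<le> 4 * w m" if "a \<in> row ` F" for a
  proof -
    define Fa where "Fa = {j. j \<in> F \<and> row j = a}"
    have Fa: "finite Fa" "Fa \<noteq> {}" using fin that by (auto simp: Fa_def)
    have "Max (floor2 ` w ` Fa) \<in> floor2 ` w ` Fa" using Fa by (intro Max_in) auto
    then obtain m where m: "m \<in> Fa" "floor2 (w m) = Max (floor2 ` w ` Fa)" by auto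
    have FaJ: "Fa \<subseteq> J" using FJ by (auto simp: Fa_def)
    have "(\<Sum>j\<in>Fa. w j) \<le> (\<Sum>j\<in>Fa. 2 * 2 powi floor2 (w j))"
      using FaJ weight_pos less_floor2 by (intro sum_mono less_imp_le) auto
    also have "\<dots> = 2 * (\<Sum>b\<in>(\<lambda>j. floor2 (w j)) ` Fa. 2 powi b)"
      using inj by (subst sum.reindex) (auto simp: inj_on_def Fa_def sum_distrib_left)
    also have "\<dots> \<le> 2 * (2 * 2 powi floor2 (w m))"
      using Fa m(2) by (intro mult_left_mono sum_powi_2_le) auto
    also have "\<dots> \<le> 4 * w m" using floor2_le[OF weight_pos] m(1) FaJ by auto
    finally show ?thesis using m(1) by (auto simp: Fa_def)
  qed
  then have "\<forall>a\<in>row ` F. \<exists>m. m \<in> F \<and> row m = a \<and> (\<Sum>j | j \<in> F \<and> row j = a. w j) \<le> 4 * w m"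
    by blast
  from bchoice[OF this] obtain m where m: "\<And>a. a \<in> row ` F \<Longrightarrow> m a \<in> F" "\<And>a. a \<in> row ` F \<Longrightarrow> row (m a) = a"
    "\<And>a. a \<in> row ` F \<Longrightarrow> (\<Sum>j | j \<in> F \<and> row j = a. w j) \<le> 4 * w (m a)"
    by blast
  have \<alpha>_pos: "0 < \<alpha>_plus j / w j" and size_le: "p j / \<epsilon> \<le> \<alpha>_plus j / w j" if "j \<in> F" for j
  proof -
    have j: "j \<in> J_plus" "j \<in> J" using that FJ FJp by auto
    show "p j / \<epsilon> \<le> \<alpha>_plus j / w j"
      using j weight_pos[OF j(2)] by (simp add: J_plus_def field_simps)
    moreover have "0 < p j / \<epsilon>" using size_pos[OF j(2)] eps_pos by simp
    ultimately show "0 < \<alpha>_plus j / w j" by linarith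
  qed
  have w_le: "w (m a) \<le> 4 * \<epsilon> * (2 powi a * (density (m a) / 2))" if "a \<in> row ` F" for a
  proof -
    have J: "m a \<in> J" using m(1) that FJ by blast
    \<comment> \<open>The factor \<open>\<epsilon>\<close> enters here: membership in
      \<open>J_plus\<close> gives \<open>p / \<epsilon> \<le> \<alpha>_plus / w\<close>, and the row
      confines the right-hand side below \<open>2 * 2 powi a\<close>.\<close>
    have "p (m a) / \<epsilon> \<le> 2 * 2 powi a"
      using size_le[OF m(1)[OF that]] less_floor2[OF \<alpha>_pos[OF m(1)[OF that]]] m(2)[OF that]
      by (simp add: row_def)
    then have "p (m a) \<le> 2 * \<epsilon> * 2 powi a" using eps_pos by (simp add: field_simps)
    then have "p (m a) * density (m a) \<le> (2 * \<epsilon> * 2 powi a) * density (m a)"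
      using density_pos[OF J] by (intro mult_right_mono) auto
    then show ?thesis using J by (simp add: weight_eq mult_ac)
  qed
  have "(\<Sum>a\<in>row ` F. 2 powi a * (density (m a) / 2)) \<le> 2 * (\<Sum>j\<in>J. real (p j) * density j)"
  proof (rule sum_powi_threshold_le)
    fix a assume a: "a \<in> row ` F"
    then have J: "m a \<in> J" using m(1) FJ by blast
    show "0 \<le> density (m a) / 2" using density_pos[OF J] by simp
    have "2 powi a \<le> \<alpha>_plus (m a) / w (m a)"
      using floor2_le[OF \<alpha>_pos[OF m(1)[OF a]]] m(2)[OF a] by (simp add: row_def)
    also note \<alpha>_plus_le_volume[OF J]
    finally show "2 powi a \<le> (\<Sum>j | j \<in> J \<and> density (m a) / 2 \<le> density j. real (p j))" .
  qed (use fin finite_jobs density_pos in \<open>auto simp: less_imp_le\<close>)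
  also have "\<dots> = 2 * (\<Sum>j\<in>J. w j)" by (simp add: weight_eq)
  finally have volume: "(\<Sum>a\<in>row ` F. 2 powi a * (density (m a) / 2)) \<le> 2 * (\<Sum>j\<in>J. w j)" .
  have "(\<Sum>j\<in>F. w j) = (\<Sum>a\<in>row ` F. \<Sum>j | j \<in> F \<and> row j = a. w j)"
    using sum.image_gen[OF fin] by blast
  also have "\<dots> \<le> (\<Sum>a\<in>row ` F. 4 * (4 * \<epsilon> * (2 powi a * (density (m a) / 2))))"
    using m(3) w_le by (intro sum_mono) force
  also have "\<dots> = 16 * \<epsilon> * (\<Sum>a\<in>row ` F. 2 powi a * (density (m a) / 2))"
    by (simp add: sum_distrib_left)
  also have "\<dots> \<le> 16 * \<epsilon> * (2 * (\<Sum>j\<in>J. w j))"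
    using volume eps_pos by (intro mult_left_mono) auto
  finally show ?thesis by (simp add: F_def)
qed

lemma weight_rejected_plus: "(\<Sum>j\<in>rejected_plus. w j) \<le> 34 * \<epsilon> * (\<Sum>j\<in>J. w j)"
proof -
  have "finite rejected_plus"
    using finite_J_plus by (simp add: rejected_plus_def)
  then have "(\<Sum>j\<in>rejected_plus. w j) = (\<Sum>j | j \<in> rejected_plus \<and> index_plus j = 0. w j)
      + (\<Sum>j | j \<in> rejected_plus \<and> index_plus j \<noteq> 0. w j)"
    by (subst sum.union_disjoint[symmetric]) (auto intro!: sum.cong)
  then show ?thesis
    using weight_rejected_plus_first weight_rejected_plus_later by (simp add: algebra_simps)
qed

end

section \<open>Totals for \<open>Jimm\<close> and for the jobs entering \<open>L\<close>\<close>

context algorithm_run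
begin

lemma weight_Jimm: "(\<Sum>j\<in>Jimm. w j) \<le> 38 * \<epsilon> * (\<Sum>j\<in>J. w j)"
proof -
  have sub: "rejected_plus \<subseteq> J" "rejected_minus \<subseteq> J"
    using J_plus_subset J_minus_subset by (auto simp: rejected_plus_def rejected_minus_def)
  then have fin: "finite rejected_plus" "finite rejected_minus"
    using finite_jobs finite_subset by blast+
  \<comment> \<open>The equation \<open>reject\<close> is recursive, since both tables depend on
    \<open>Jimm\<close> through \<open>active\<close>; it is applied exactly once.\<close>
  have "(\<Sum>j\<in>Jimm. w j) = (\<Sum>j\<in>rejected_plus \<union> rejected_minus. w j)"
    using arg_cong[OF reject, of "sum w"] .
  also have "\<dots> = (\<Sum>j\<in>rejected_plus. w j) + (\<Sum>j\<in>rejected_minus. w j)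
      - (\<Sum>j\<in>rejected_plus \<inter> rejected_minus. w j)"
    using fin by (rule sum_Un)
  finally have "(\<Sum>j\<in>Jimm. w j) = \<dots>" .
  moreover have "0 \<le> (\<Sum>j\<in>rejected_plus \<inter> rejected_minus. w j)"
    using sub weight_pos by (intro sum_nonneg) (auto simp: less_imp_le)
  ultimately show ?thesis
    using weight_rejected_plus weight_rejected_minus by linarith
qed

lemma proc_cases:
  assumes "proc t = Some j"
  shows "must_continue t j \<or> j \<in> active t"
proof (cases "\<exists>i. must_continue t i")
  case True
  then show ?thesis using continue_job assms by (metis option.inject)
next
  case False
  then show ?thesis using choose_job[of t] assms by simp
qed

lemma proc_rem_time_pos: "proc t = Some j \<Longrightarrow> 0 < rem_time j t"
  using proc_cases by (auto simp: must_continue_def active_def)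

text \<open>A starting job did not run in the preceding slot, so it is no forced continuation and
  was chosen among the active jobs.\<close>

lemma starts_at_mem: "starts_at j t \<Longrightarrow> j \<in> J"
  using proc_cases[of t j] by (auto simp: starts_at_def must_continue_def active_def)

text \<open>Only completion removes a job from \<open>L\<close>, and work left at \<open>t\<close>
  means work left at every earlier time.\<close>

lemma L_mono:
  assumes "s \<le> t" "0 < rem_time j t" "j \<in> L s"
  shows "j \<in> L t"
  using assms
proof (induction t rule: int_ge_induct)
  case (step t)
  have "0 < rem_time j t" using step.prems(1) rem_time_antimono[of t "t + 1" j] by simp
  then show ?case using step L_step[of "t + 1"] by auto
qed

text \<open>At each intermediate time work is left, as \<open>j\<close> still runs at
  \<open>t\<close>, and \<open>j\<close> is not yet in \<open>L\<close>, as it would have stayed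
  there until \<open>t\<close>; so continuing \<open>j\<close> is forced.\<close>

lemma uninterrupted:
  assumes "starts_at j t'" "proc t = Some j" "j \<notin> L t" "t' \<le> s" "s \<le> t"
  shows "proc s = Some j"
  using assms(4,5)
proof (induction s rule: int_ge_induct)
  case base
  then show ?case using assms(1) by (simp add: starts_at_def)
next
  case (step s)
  have pos: "0 < rem_time j t" using assms(2) by (rule proc_rem_time_pos)
  then have "0 < rem_time j (s + 1)"
    using rem_time_antimono[OF step.prems, of j] by simp
  moreover have "j \<notin> L (s + 1)" using L_mono[OF step.prems pos] assms(3) by blast
  ultimately show ?case using step by (intro continue_job) (simp add: must_continue_def)
qed

lemma weight_ever_L: "(\<Sum>j\<in>ever_L. w j) \<le> \<epsilon> * (\<Sum>j\<in>J. w j)"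
proof -
  have sub: "ever_L \<subseteq> J" by (auto simp: ever_L_def enters_L_def dest: starts_at_mem)
  then have fin: "finite ever_L" using finite_jobs finite_subset by blast
  have "\<forall>j\<in>ever_L. \<exists>e b. proc (e - 1) = Some j \<and> j \<notin> L (e - 1) \<and> starts_at j b \<and>
      (\<Sum>i \<in> {i \<in> J. b < r i \<and> r i \<le> e}. w i) > w j / \<epsilon>"
    by (auto simp: ever_L_def enters_L_def)
  from bchoice[OF this] obtain e where "\<forall>j\<in>ever_L. \<exists>b. proc (e j - 1) = Some j \<and> j \<notin> L (e j - 1) \<and>
      starts_at j b \<and> (\<Sum>i \<in> {i \<in> J. b < r i \<and> r i \<le> e j}. w i) > w j / \<epsilon>"
    by blast
  from bchoice[OF this] obtain b where e: "\<And>j. j \<in> ever_L \<Longrightarrow> proc (e j - 1) = Some j \<and> j \<notin> L (e j - 1) \<and>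
      starts_at j (b j) \<and> (\<Sum>i \<in> {i \<in> J. b j < r i \<and> r i \<le> e j}. w i) > w j / \<epsilon>"
    by blast
  define S where "S j = {i \<in> J. b j < r i \<and> r i \<le> e j}" for j
  \<comment> \<open>An arrival after \<open>b j\<close> and up to \<open>e j\<close> ends a slot
    that starts between \<open>b j\<close> and \<open>e j - 1\<close>, where \<open>j\<close> runs.
    The slot before its release thus determines \<open>j\<close>, so the sets \<open>S j\<close> are
    disjoint.\<close>
  have S_proc: "proc (r i - 1) = Some j" if "j \<in> ever_L" "i \<in> S j" for i j
    by (rule uninterrupted[of j "b j" "e j - 1"]) (use e[OF that(1)] that(2) in \<open>auto simp: S_def\<close>)
  have disj: "S i \<inter> S j = {}" if "i \<in> ever_L" "j \<in> ever_L" "i \<noteq> j" for i j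
  proof (rule ccontr)
    assume "S i \<inter> S j \<noteq> {}"
    then obtain k where "k \<in> S i" "k \<in> S j" by blast
    then show False using S_proc[OF that(1)] S_proc[OF that(2)] that(3) by (metis option.inject)
  qed
  have "(\<Sum>j\<in>ever_L. w j) \<le> (\<Sum>j\<in>ever_L. \<epsilon> * (\<Sum>i\<in>S j. w i))"
    using e eps_pos by (intro sum_mono) (force simp: S_def field_simps)
  also have "\<dots> = \<epsilon> * (\<Sum>i\<in>(\<Union>j\<in>ever_L. S j). w i)"
    using fin disj finite_jobs
    by (subst sum.UNION_disjoint) (auto simp: sum_distrib_left S_def)
  also have "\<dots> \<le> \<epsilon> * (\<Sum>j\<in>J. w j)"
    using eps_pos finite_jobs weight_pos
    by (intro mult_left_mono sum_mono2) (auto simp: S_def less_imp_le)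
  finally show ?thesis .
qed

end

theorem theorem4p1:
  shows "\<exists>C > 0. \<forall>(J :: nat set) r p w tie \<epsilon> proc Jimm L.
    algorithm_run J r p w tie \<epsilon> proc Jimm L \<longrightarrow>
      (\<Sum>j \<in> Jimm. w j) + (\<Sum>j \<in> trace.ever_L J r w \<epsilon> proc L. w j)
        \<le> C * \<epsilon> * (\<Sum>j \<in> J. w j)"
\<comment> \<open>38 for the immediate rejections and 1 for \<open>L\<close>.\<close>
proof (intro exI[of _ 39] conjI allI impI)
  fix J :: "nat set" and r p w tie \<epsilon> proc Jimm L
  assume run: "algorithm_run J r p w tie \<epsilon> proc Jimm L"
  show "(\<Sum>j \<in> Jimm. w j) + (\<Sum>j \<in> trace.ever_L J r w \<epsilon> proc L. w j)
      \<le> 39 * \<epsilon> * (\<Sum>j \<in> J. w j)"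
    using algorithm_run.weight_Jimm[OF run] algorithm_run.weight_ever_L[OF run]
    by (simp add: algebra_simps)
qed simp

end
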